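(* Let $\mathbb{B}_0=(X_1,X_2,X_3)$ be the basis of $\mathrm{sl}(2,\mathbb{R})$ with $[X_1,X_2]=2X_3$, $[X_3,X_1]=2X_2$, $[X_3,X_2]=2X_1$. Let $\mu_1>0$, $\mu_2\ge\mu_3>0$ and let $h$ be the left invariant metric on $\widetilde{\mathrm{PSL}}(2,\mathbb{R})$ with matrix $\mathrm{diag}(-\mu_1,\mu_2,\mu_3)$ in $\mathbb{B}_0$. Its Ricci curvature and scalar curvature are $$M(\mathrm{ric},\mathbb{B}_0)=\mathrm{diag}\left[\tfrac{2(\mu_1^2-(\mu_2-\mu_3)^2)}{\mu_2\mu_3},\ -\tfrac{2(\mu_2^2-(\mu_1-\mu_3)^2)}{\mu_1\mu_3},\ -\tfrac{2(\mu_3^2-(\mu_2-\mu_1)^2)}{\mu_1\mu_2}\right],$$ $$\mathfrak{s}=\frac{2\big[(\sqrt{\mu_1}+\sqrt{\mu_2})^2-\mu_3\big]\big[(\sqrt{\mu_1}-\sqrt{\mu_2})^2-\mu_3\big]}{\mu_1\mu_2\mu_3}.$$ When $\mu_1=\mu_2=\mu_3=\mu$, one has $\mathrm{ric}=-\frac2\mu h$ and in fact the metric has constant sectional curvature $-\frac1\mu$. The possible signatures of the Ricci curvature (as $\mu_1,\mu_2,\mu_3$ vary in the range $\mu_1>0$, $\mu_2\ge\mu_3>0$) are $(+,+,+)$, $(+,-,-)$, $(+,0,0)$, $(-,0,0)$.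
   Context: $\widetilde{\mathrm{PSL}}(2,\mathbb{R})$ is the universal covering group of $\mathrm{SL}(2,\mathbb{R})$. A left invariant metric on a Lie group with Lie algebra $\mathfrak{g}$ is identified with a nondegenerate symmetric bilinear form $\langle\,,\rangle$ on $\mathfrak{g}$. The Levi-Civita product $\mathrm{L}:\mathfrak{g}\times\mathfrak{g}\to\mathfrak{g}$ is given by $2\langle\mathrm{L}_uv,w\rangle=\langle[u,v],w\rangle+\langle[w,u],v\rangle+\langle[w,v],u\rangle$, the curvature by $\mathrm{K}(u,v)=\mathrm{L}_{[u,v]}-[\mathrm{L}_u,\mathrm{L}_v]$, the Ricci tensor by $\mathrm{ric}(u,v)=\mathrm{tr}(w\mapsto\mathrm{K}(u,w)v)$, the Ricci operator by $\langle\mathrm{Ric}(u),v\rangle=\mathrm{ric}(u,v)$, and the scalar curvature by $\mathfrak{s}=\mathrm{tr}(\mathrm{Ric})$. $M(\mathrm{ric},\mathbb{B}_0)$ is the Gram matrix of $\mathrm{ric}$ in $\mathbb{B}_0$. Constant sectional curvature $\kappa$ has the usual meaning, which with the sign convention $\mathrm{K}(u,v)=\mathrm{L}_{[u,v]}-[\mathrm{L}_u,\mathrm{L}_v]$ reads $\mathrm{K}(u,v)w=-\kappa(\langle v,w\rangle u-\langle u,w\rangle v)$ for all $u,v,w\in\mathfrak{g}$. The signature of $\mathrm{ric}$ is its signature as a symmetric bilinear form (signs listed in any order). *)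

theory Defs
  imports "HOL-Analysis.Analysis"
begin

section \<open>Linear algebra on a subspace\<close>

definition bilinear_form_on :: "'a::real_vector set \<Rightarrow> ('a \<Rightarrow> 'a \<Rightarrow> real) \<Rightarrow> bool" where
  "bilinear_form_on V b \<longleftrightarrow>
     (\<forall>u\<in>V. \<forall>v\<in>V. \<forall>w\<in>V. b (u + v) w = b u w + b v w \<and> b w (u + v) = b w u + b w v) \<and>
     (\<forall>c. \<forall>u\<in>V. \<forall>v\<in>V. b (c *\<^sub>R u) v = c * b u v \<and> b u (c *\<^sub>R v) = c * b u v)"

definition symmetric_form_on :: "'a set \<Rightarrow> ('a \<Rightarrow> 'a \<Rightarrow> real) \<Rightarrow> bool" where
  "symmetric_form_on V b \<longleftrightarrow> (\<forall>u\<in>V. \<forall>v\<in>V. b u v = b v u)"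

definition nondegenerate_form_on :: "'a::real_vector set \<Rightarrow> ('a \<Rightarrow> 'a \<Rightarrow> real) \<Rightarrow> bool" where
  "nondegenerate_form_on V b \<longleftrightarrow> (\<forall>u\<in>V. (\<forall>v\<in>V. b u v = 0) \<longrightarrow> u = 0)"

text \<open>A left invariant metric on a Lie group with Lie algebra \<open>V\<close>, as a form on \<open>V\<close>.\<close>

definition left_invariant_metric :: "'a::real_vector set \<Rightarrow> ('a \<Rightarrow> 'a \<Rightarrow> real) \<Rightarrow> bool" where
  "left_invariant_metric V g \<longleftrightarrow>
     bilinear_form_on V g \<and> symmetric_form_on V g \<and> nondegenerate_form_on V g"

definition ordered_basis :: "'a::real_vector set \<Rightarrow> ('n \<Rightarrow> 'a) \<Rightarrow> bool" where
  "ordered_basis V X \<longleftrightarrow> inj X \<and> independent (range X) \<and> span (range X) = V"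

definition gram_matrix :: "('n \<Rightarrow> 'a) \<Rightarrow> ('a \<Rightarrow> 'a \<Rightarrow> real) \<Rightarrow> real ^ 'n ^ 'n" where
  "gram_matrix X b = (\<chi> i j. b (X i) (X j))"

definition diag3 :: "real \<Rightarrow> real \<Rightarrow> real \<Rightarrow> real ^ 3 ^ 3" where
  "diag3 a b c = vector [vector [a, 0, 0], vector [0, b, 0], vector [0, 0, c]]"

text \<open>The trace of an endomorphism \<open>f\<close> of \<open>V\<close>; independence of the chosen basis is
  \<open>trace_on_eq\<close> below.\<close>

definition trace_on :: "'a::real_vector set \<Rightarrow> ('a \<Rightarrow> 'a) \<Rightarrow> real" where
  "trace_on V f =
     (let B = (SOME B. independent B \<and> span B = V) in \<Sum>b\<in>B. representation B (f b) b)"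

text \<open>The signature of a symmetric bilinear form as
  (number of \<open>+\<close>, number of \<open>-\<close>, number of \<open>0\<close>): the maximal dimensions of a positive definite
  and of a negative definite subspace, and the dimension of the radical.\<close>

definition form_signature :: "'a::real_vector set \<Rightarrow> ('a \<Rightarrow> 'a \<Rightarrow> real) \<Rightarrow> nat \<times> nat \<times> nat" where
  "form_signature V b =
     (Max {dim W | W. subspace W \<and> W \<subseteq> V \<and> (\<forall>w\<in>W. w \<noteq> 0 \<longrightarrow> b w w > 0)},
      Max {dim W | W. subspace W \<and> W \<subseteq> V \<and> (\<forall>w\<in>W. w \<noteq> 0 \<longrightarrow> b w w < 0)},
      dim {v \<in> V. \<forall>w\<in>V. b v w = 0})"

section \<open>Curvature of a left invariant metric\<close>

text \<open>Throughout, \<open>V\<close> is the Lie algebra, \<open>br\<close> its bracket and \<open>g\<close> the metric. Values at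
  arguments outside \<open>V\<close> are irrelevant.\<close>

definition levi_civita ::
  "'a::real_vector set \<Rightarrow> ('a \<Rightarrow> 'a \<Rightarrow> 'a) \<Rightarrow> ('a \<Rightarrow> 'a \<Rightarrow> real) \<Rightarrow> 'a \<Rightarrow> 'a \<Rightarrow> 'a" where
  "levi_civita V br g u v =
     (THE x. x \<in> V \<and> (\<forall>w\<in>V. 2 * g x w = g (br u v) w + g (br w u) v + g (br w v) u))"

text \<open>With this sign convention, \<open>K\<close> is the negative of \<open>[\<nabla>\<^sub>u, \<nabla>\<^sub>v] - \<nabla>\<^bsub>[u,v]\<^esub>\<close>.\<close>

definition curvature ::
  "'a::real_vector set \<Rightarrow> ('a \<Rightarrow> 'a \<Rightarrow> 'a) \<Rightarrow> ('a \<Rightarrow> 'a \<Rightarrow> real) \<Rightarrow> 'a \<Rightarrow> 'a \<Rightarrow> 'a \<Rightarrow> 'a" where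
  "curvature V br g u v w =
     (let L = levi_civita V br g in L (br u v) w - (L u (L v w) - L v (L u w)))"

definition ricci ::
  "'a::real_vector set \<Rightarrow> ('a \<Rightarrow> 'a \<Rightarrow> 'a) \<Rightarrow> ('a \<Rightarrow> 'a \<Rightarrow> real) \<Rightarrow> 'a \<Rightarrow> 'a \<Rightarrow> real" where
  "ricci V br g u v = trace_on V (\<lambda>w. curvature V br g u w v)"

definition ricci_operator ::
  "'a::real_vector set \<Rightarrow> ('a \<Rightarrow> 'a \<Rightarrow> 'a) \<Rightarrow> ('a \<Rightarrow> 'a \<Rightarrow> real) \<Rightarrow> 'a \<Rightarrow> 'a" where
  "ricci_operator V br g u = (THE x. x \<in> V \<and> (\<forall>v\<in>V. g x v = ricci V br g u v))"

definition scalar_curvature ::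
  "'a::real_vector set \<Rightarrow> ('a \<Rightarrow> 'a \<Rightarrow> 'a) \<Rightarrow> ('a \<Rightarrow> 'a \<Rightarrow> real) \<Rightarrow> real" where
  "scalar_curvature V br g = trace_on V (ricci_operator V br g)"

definition constant_sectional_curvature ::
  "'a::real_vector set \<Rightarrow> ('a \<Rightarrow> 'a \<Rightarrow> 'a) \<Rightarrow> ('a \<Rightarrow> 'a \<Rightarrow> real) \<Rightarrow> real \<Rightarrow> bool" where
  "constant_sectional_curvature V br g \<kappa> \<longleftrightarrow>
     (\<forall>u\<in>V. \<forall>v\<in>V. \<forall>w\<in>V. curvature V br g u v w = (- \<kappa>) *\<^sub>R (g v w *\<^sub>R u - g u w *\<^sub>R v))"

section \<open>The Lie algebra of the universal covering group of \<open>SL(2,\<real>)\<close>\<close>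

definition sl2 :: "(real ^ 2 ^ 2) set" where
  "sl2 = {A. trace A = 0}"

definition commutator :: "real ^ 2 ^ 2 \<Rightarrow> real ^ 2 ^ 2 \<Rightarrow> real ^ 2 ^ 2" where
  "commutator A B = A ** B - B ** A"

definition standard_sl2_basis :: "(3 \<Rightarrow> real ^ 2 ^ 2) \<Rightarrow> bool" where
  "standard_sl2_basis X \<longleftrightarrow> ordered_basis sl2 X \<and>
     commutator (X 1) (X 2) = 2 *\<^sub>R X 3 \<and>
     commutator (X 3) (X 1) = 2 *\<^sub>R X 2 \<and>
     commutator (X 3) (X 2) = 2 *\<^sub>R X 1"

section \<open>Sanity checks\<close>

lemma trace_on_eq:
  fixes V :: "'a::euclidean_space set"
  assumes C: "independent C" "span C = V"
    and fV: "\<And>v. v \<in> V \<Longrightarrow> f v \<in> V"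
    and add: "\<And>u v. u \<in> V \<Longrightarrow> v \<in> V \<Longrightarrow> f (u + v) = f u + f v"
    and scale: "\<And>c v. v \<in> V \<Longrightarrow> f (c *\<^sub>R v) = c *\<^sub>R f v"
  shows "trace_on V f = (\<Sum>c\<in>C. representation C (f c) c)"
proof -
  have expand: "(\<Sum>e\<in>E. representation E v e *\<^sub>R e) = v"
    if "independent E" "span E = V" "v \<in> V" for E v
    using that by (intro real_vector.sum_representation_eq) (auto intro: independent_imp_finite)
  have f0: "f 0 = 0"
    using scale[of 0 0] C(2) span_zero[of C] by simp
  have sum_V: "(\<Sum>i\<in>I. a i *\<^sub>R e i) \<in> V" if "\<And>i. i \<in> I \<Longrightarrow> e i \<in> V"
    for I :: "'a set" and a :: "'a \<Rightarrow> real" and e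
    unfolding C(2)[symmetric]
    by (intro span_sum span_scale) (use that C(2) in auto)
  have f_sum: "f (\<Sum>i\<in>I. a i *\<^sub>R e i) = (\<Sum>i\<in>I. a i *\<^sub>R f (e i))"
    if "finite I" "\<And>i. i \<in> I \<Longrightarrow> e i \<in> V" for I :: "'a set" and a :: "'a \<Rightarrow> real" and e
    using that
  proof (induction I rule: finite_induct)
    case (insert x F)
    have "a x *\<^sub>R e x \<in> V"
      unfolding C(2)[symmetric]
      by (intro span_scale) (use insert.prems C(2) in auto)
    moreover have "(\<Sum>i\<in>F. a i *\<^sub>R e i) \<in> V"
      using insert.prems by (intro sum_V) auto
    ultimately show ?case
      using insert by (simp add: add scale)
  qed (simp add: f0)
  have rep_sum: "representation E (\<Sum>i\<in>I. a i *\<^sub>R e i) x = (\<Sum>i\<in>I. a i * representation E (e i) x)"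
    if E: "independent E" "span E = V" and e: "\<And>i. i \<in> I \<Longrightarrow> e i \<in> V"
    for E and I :: "'a set" and a :: "'a \<Rightarrow> real" and e x
  proof -
    have "a i *\<^sub>R e i \<in> span E" if "i \<in> I" for i
      by (intro span_scale) (use e[OF that] E(2) in simp)
    then show ?thesis
      using E e by (simp add: real_vector.representation_sum real_vector.representation_scale)
  qed
  define B where "B = (SOME B. independent B \<and> span B = V)"
  have "independent B \<and> span B = V"
    unfolding B_def using someI[of "\<lambda>B. independent B \<and> span B = V" C] C by blast
  then have B: "independent B" "span B = V" by auto
  have fin: "finite B" "finite C"
    using B C by (auto intro: independent_imp_finite)
  have sub: "B \<subseteq> V" "C \<subseteq> V"
    using B C span_superset by blast+
  have "trace_on V f = (\<Sum>b\<in>B. representation B (f b) b)"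
    by (simp add: trace_on_def B_def Let_def)
  also have "\<dots> = (\<Sum>b\<in>B. \<Sum>c\<in>C. representation C b c * representation B (f c) b)"
  proof (rule sum.cong[OF refl])
    fix b assume b: "b \<in> B"
    have "f b = f (\<Sum>c\<in>C. representation C b c *\<^sub>R c)"
      using expand[OF C] b sub by auto
    also have "\<dots> = (\<Sum>c\<in>C. representation C b c *\<^sub>R f c)"
      using fin sub by (intro f_sum) auto
    finally show "representation B (f b) b = (\<Sum>c\<in>C. representation C b c * representation B (f c) b)"
      by (simp only: rep_sum[OF B, of C f] fV subsetD[OF sub(2)])
  qed
  also have "\<dots> = (\<Sum>c\<in>C. \<Sum>b\<in>B. representation B (f c) b * representation C b c)"
    by (subst sum.swap) (simp add: mult.commute)
  also have "\<dots> = (\<Sum>c\<in>C. representation C (f c) c)"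
  proof (rule sum.cong[OF refl])
    fix c assume c: "c \<in> C"
    have "f c = (\<Sum>b\<in>B. representation B (f c) b *\<^sub>R b)"
      using expand[OF B] c sub fV by auto
    then have "representation C (f c) c =
        representation C (\<Sum>b\<in>B. representation B (f c) b *\<^sub>R b) c"
      by (rule arg_cong)
    also have "\<dots> = (\<Sum>b\<in>B. representation B (f c) b * representation C b c)"
      using sub by (intro rep_sum[OF C]) auto
    finally show "(\<Sum>b\<in>B. representation B (f c) b * representation C b c) = representation C (f c) c"
      by (rule sym)
  qed
  finally show ?thesis .
qed

lemma standard_sl2_basis_exists: "\<exists>X. standard_sl2_basis X"
proof -
  define X1 X2 X3 :: "real ^ 2 ^ 2" where
    "X1 = vector [vector [0, -1], vector [1, 0]]" and
    "X2 = vector [vector [1, 0], vector [0, -1]]" and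
    "X3 = vector [vector [0, 1], vector [1, 0]]"
  define X :: "3 \<Rightarrow> real ^ 2 ^ 2" where "X = (\<lambda>i. if i = 1 then X1 else if i = 2 then X2 else X3)"
  note defs = X1_def X2_def X3_def
  have vals: "X 1 = X1" "X 2 = X2" "X 3 = X3"
    by (auto simp: X_def)
  have range: "range X = {X1, X2, X3}"
    using vals by (auto simp: UNIV_3)
  have ne: "X1 \<noteq> X2" "X1 \<noteq> X3" "X2 \<noteq> X3"
    by (auto simp: defs vec_eq_iff forall_2)
  have "inj X"
    using ne by (simp add: inj_def forall_3 vals)
  moreover have "independent (range X)"
    unfolding range
  proof (rule independent_if_scalars_zero)
    fix f x
    assume "(\<Sum>x\<in>{X1, X2, X3}. f x *\<^sub>R x) = 0" and x: "x \<in> {X1, X2, X3}"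
    then have "f X1 *\<^sub>R X1 + (f X2 *\<^sub>R X2 + f X3 *\<^sub>R X3) = 0"
      using ne by simp
    moreover have "a = 0 \<and> b = 0 \<and> c = 0" if "a *\<^sub>R X1 + (b *\<^sub>R X2 + c *\<^sub>R X3) = 0" for a b c
      using that by (auto simp: defs vec_eq_iff forall_2)
    ultimately show "f x = 0"
      using x by blast
  qed simp
  moreover have "span (range X) = sl2"
  proof
    have "subspace sl2"
      by (auto simp: sl2_def subspace_def trace_def sum_2 distrib_left[symmetric])
    then show "span (range X) \<subseteq> sl2"
      unfolding range by (intro span_minimal) (auto simp: sl2_def trace_def sum_2 defs)
    show "sl2 \<subseteq> span (range X)"
    proof
      fix A assume "A \<in> sl2"
      then have "A = ((A$2$1 - A$1$2) / 2) *\<^sub>R X1 + (A$1$1) *\<^sub>R X2 + ((A$2$1 + A$1$2) / 2) *\<^sub>R X3"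
        by (auto simp: sl2_def trace_def sum_2 defs vec_eq_iff forall_2 field_simps)
      also have "\<dots> \<in> span (range X)"
        unfolding range by (intro span_add span_scale span_base) auto
      finally show "A \<in> span (range X)" .
    qed
  qed
  ultimately have "standard_sl2_basis X"
    by (auto simp: standard_sl2_basis_def ordered_basis_def vals commutator_def defs
        matrix_matrix_mult_def vec_eq_iff forall_2 sum_2)
  then show ?thesis by blast
qed

end

theory Submission
  imports Defs
begin

text \<open>In the basis \<open>X\<close> the Levi-Civita product takes distinct \<open>X i\<close>, \<open>X j\<close> to multiples of the third
  basis vector and vanishes on equal ones. Hence the Ricci form is diagonal, with entries
  quadratic in the six structure constants. Its signature is then read off from the signs of the
  entries by Sylvester's law of inertia.\<close>

section \<open>Coordinates with respect to an ordered basis\<close>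

text \<open>Coordinates are vectors in \<open>real ^ 'n\<close>, so that geometric identities in
  \<open>V\<close> become polynomial identities between components.\<close>

definition lin_comb :: "('n::finite \<Rightarrow> 'a::real_vector) \<Rightarrow> real ^ 'n \<Rightarrow> 'a" where
  "lin_comb X x = (\<Sum>i\<in>UNIV. x $ i *\<^sub>R X i)"

lemma linear_lin_comb: "linear (lin_comb X)"
  by (rule linearI) (simp_all add: lin_comb_def scaleR_left_distrib sum.distrib scaleR_sum_right)

lemmas lin_comb_add = linear_add[OF linear_lin_comb]
  and lin_comb_diff = linear_diff[OF linear_lin_comb]
  and lin_comb_scale = linear_scale[OF linear_lin_comb]

lemma lin_comb_axis: "lin_comb X (axis i 1) = X i"
proof -
  have "lin_comb X (axis i 1) = (\<Sum>j\<in>UNIV. if j = i then X j else 0)"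
    unfolding lin_comb_def by (rule sum.cong) (auto simp: axis_def)
  then show ?thesis by simp
qed

lemma lin_comb_3: "lin_comb X x = x $ 1 *\<^sub>R X 1 + x $ 2 *\<^sub>R X 2 + x $ 3 *\<^sub>R X (3::3)"
  by (simp add: lin_comb_def sum_3)

lemma ordered_basis_subspace: "ordered_basis V X \<Longrightarrow> subspace V"
  by (auto simp: ordered_basis_def)

lemma ordered_basis_in: "ordered_basis V X \<Longrightarrow> X i \<in> V"
  by (auto simp: ordered_basis_def intro: span_base)

lemma lin_comb_in: "ordered_basis V X \<Longrightarrow> lin_comb X x \<in> V"
  unfolding lin_comb_def
  by (intro subspace_sum subspace_scale) (auto intro: ordered_basis_subspace ordered_basis_in)

lemma representation_lin_comb:
  assumes "ordered_basis V X"
  shows "representation (range X) (lin_comb X x) (X i) = x $ i"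
proof -
  have ind: "independent (range X)" and inj: "inj X"
    using assms by (auto simp: ordered_basis_def)
  have "representation (range X) (lin_comb X x) (X i) =
      (\<Sum>j\<in>UNIV. x $ j * representation (range X) (X j) (X i))"
    unfolding lin_comb_def using ind
    by (simp add: real_vector.representation_sum real_vector.representation_scale span_base span_scale)
  also have "\<dots> = (\<Sum>j\<in>UNIV. if j = i then x $ j else 0)"
    by (rule sum.cong) (use inj in \<open>auto simp: real_vector.representation_basis[OF ind] dest: injD\<close>)
  finally show ?thesis by simp
qed

lemma lin_comb_eq_iff:
  assumes "ordered_basis V X"
  shows "lin_comb X x = lin_comb X y \<longleftrightarrow> x = y"
proof
  assume eq: "lin_comb X x = lin_comb X y"
  have "x $ i = y $ i" for i
    using representation_lin_comb[OF assms, of x i] representation_lin_comb[OF assms, of y i]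
    unfolding eq by simp
  then show "x = y" by (simp add: vec_eq_iff)
qed simp

lemma lin_comb_cases:
  assumes "ordered_basis V X" "v \<in> V"
  obtains x where "v = lin_comb X x"
proof
  have ind: "independent (range X)" and inj: "inj X" and sp: "span (range X) = V"
    using assms by (auto simp: ordered_basis_def)
  have "v = (\<Sum>b\<in>range X. representation (range X) v b *\<^sub>R b)"
    by (rule real_vector.sum_representation_eq[symmetric]) (use ind sp assms in auto)
  also have "\<dots> = lin_comb X (\<chi> i. representation (range X) v (X i))"
    by (simp add: lin_comb_def sum.reindex[OF inj])
  finally show "v = lin_comb X (\<chi> i. representation (range X) v (X i))" .
qed

text \<open>By \<open>trace_on_eq\<close> the arbitrary basis chosen inside \<open>trace_on\<close>
  may be replaced by \<open>range X\<close>. The map \<open>f\<close> inherits linearity on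
  \<open>V\<close> from \<open>F\<close>.\<close>

lemma trace_on_lin_comb:
  fixes X :: "'n::finite \<Rightarrow> 'a::euclidean_space"
  assumes X: "ordered_basis V X" and F: "linear F"
    and f: "\<And>x. f (lin_comb X x) = lin_comb X (F x)"
  shows "trace_on V f = (\<Sum>i\<in>UNIV. F (axis i 1) $ i)"
proof -
  have ind: "independent (range X)" and inj: "inj X" and sp: "span (range X) = V"
    using X by (auto simp: ordered_basis_def)
  have "trace_on V f = (\<Sum>c\<in>range X. representation (range X) (f c) c)"
  proof (rule trace_on_eq[OF ind sp])
    fix v assume "v \<in> V"
    then obtain x where v: "v = lin_comb X x" by (rule lin_comb_cases[OF X])
    show "f v \<in> V" by (simp add: v f lin_comb_in[OF X])
    show "f (c *\<^sub>R v) = c *\<^sub>R f v" for c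
      by (simp add: v f lin_comb_scale[symmetric] linear_scale[OF F])
  next
    fix u v assume "u \<in> V" "v \<in> V"
    then obtain x y where "u = lin_comb X x" "v = lin_comb X y"
      by (meson lin_comb_cases[OF X])
    then show "f (u + v) = f u + f v"
      by (simp add: f lin_comb_add[symmetric] linear_add[OF F])
  qed
  also have "\<dots> = (\<Sum>i\<in>UNIV. representation (range X) (f (X i)) (X i))"
    by (simp add: sum.reindex[OF inj])
  also have "\<dots> = (\<Sum>i\<in>UNIV. F (axis i 1) $ i)"
  proof (rule sum.cong[OF refl])
    fix i
    have "f (X i) = lin_comb X (F (axis i 1))"
      using f[of "axis i 1"] by (simp add: lin_comb_axis)
    then show "representation (range X) (f (X i)) (X i) = F (axis i 1) $ i"
      by (simp add: representation_lin_comb[OF X])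
  qed
  finally show ?thesis .
qed

text \<open>Bilinearity is available on \<open>V\<close> only, so each induction over the sum must
  also keep the partial sums inside \<open>V\<close>.\<close>

lemma bilinear_form_on_lin_comb:
  assumes X: "ordered_basis V X" and b: "bilinear_form_on V b"
  shows "b (lin_comb X x) (lin_comb X y) = (\<Sum>i\<in>UNIV. \<Sum>j\<in>UNIV. x $ i * y $ j * b (X i) (X j))"
proof -
  note V = ordered_basis_subspace[OF X] and XV = ordered_basis_in[OF X]
  \<comment> \<open>Homogeneity with the scalar 0 gives the base case of both inductions.\<close>
  have zero: "b 0 w = 0" "b w 0 = 0" if "w \<in> V" for w
  proof -
    have "b (0 *\<^sub>R w) w = 0 * b w w" "b w (0 *\<^sub>R w) = 0 * b w w"
      using b that unfolding bilinear_form_on_def by blast+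
    then show "b 0 w = 0" "b w 0 = 0" by simp_all
  qed
  have left: "b (\<Sum>i\<in>I. x $ i *\<^sub>R X i) w = (\<Sum>i\<in>I. x $ i * b (X i) w)"
    if "w \<in> V" "finite I" for I w
    using that(2)
  proof induction
    case (insert i I)
    have "(\<Sum>i\<in>I. x $ i *\<^sub>R X i) \<in> V" "x $ i *\<^sub>R X i \<in> V"
      using V XV by (auto intro!: subspace_sum subspace_scale)
    then show ?case
      using insert b that(1) XV by (simp add: bilinear_form_on_def)
  qed (simp add: zero that)
  have right: "b w (\<Sum>i\<in>I. y $ i *\<^sub>R X i) = (\<Sum>i\<in>I. y $ i * b w (X i))"
    if "w \<in> V" "finite I" for I w
    using that(2)
  proof induction
    case (insert i I)
    have "(\<Sum>i\<in>I. y $ i *\<^sub>R X i) \<in> V" "y $ i *\<^sub>R X i \<in> V"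
      using V XV by (auto intro!: subspace_sum subspace_scale)
    then show ?case
      using insert b that(1) XV by (simp add: bilinear_form_on_def)
  qed (simp add: zero that)
  have "b (lin_comb X x) (lin_comb X y) = (\<Sum>i\<in>UNIV. x $ i * b (X i) (lin_comb X y))"
    using left[OF lin_comb_in[OF X], of UNIV] by (simp add: lin_comb_def)
  also have "\<dots> = (\<Sum>i\<in>UNIV. \<Sum>j\<in>UNIV. x $ i * y $ j * b (X i) (X j))"
    using right[OF XV, of UNIV] by (simp add: lin_comb_def sum_distrib_left mult.assoc)
  finally show ?thesis .
qed

text \<open>Nondegeneracy applied to \<open>x - y\<close>. It supplies uniqueness for the definite
  descriptions in \<open>levi_civita\<close> and \<open>ricci_operator\<close>.\<close>

lemma metric_cancel:
  assumes V: "subspace V" and g: "left_invariant_metric V g"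
    and xy: "x \<in> V" "y \<in> V" and eq: "\<And>w. w \<in> V \<Longrightarrow> g x w = g y w"
  shows "x = y"
proof -
  have "g (x - y) w = 0" if w: "w \<in> V" for w
  proof -
    have "x - y \<in> V" using V xy by (rule subspace_diff)
    \<comment> \<open>\<open>bilinear_form_on\<close> speaks of sums, so the difference is handled
      by splitting \<open>x\<close> as \<open>(x - y) + y\<close>.\<close>
    then have "g ((x - y) + y) w = g (x - y) w + g y w"
      using g w xy unfolding left_invariant_metric_def bilinear_form_on_def by blast
    then show ?thesis using eq[OF w] by simp
  qed
  moreover have "x - y \<in> V" using V xy by (rule subspace_diff)
  ultimately show "x = y"
    using g unfolding left_invariant_metric_def nondegenerate_form_on_def by fastforce
qed

section \<open>The signature of a diagonal form\<close>

lemma dim_basis_part: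
  fixes X :: "'n::finite \<Rightarrow> 'a::euclidean_space"
  assumes "ordered_basis V X"
  shows "dim (span (X ` I)) = card I"
proof -
  have "independent (X ` I)" "inj_on X I"
    using assms independent_mono[of "range X" "X ` I"] inj_on_subset[of X UNIV I]
    by (simp_all add: ordered_basis_def image_mono)
  then show ?thesis by (simp add: dim_span dim_eq_card_independent card_image)
qed

text \<open>The coordinate vectors supported on \<open>I\<close> form a subspace whose image
  contains the basis vectors indexed by \<open>I\<close>. By minimality the span lies in that image,
  and coordinates are unique.\<close>

lemma lin_comb_in_span_part:
  assumes X: "ordered_basis V X"
  shows "lin_comb X x \<in> span (X ` I) \<longleftrightarrow> (\<forall>i. i \<notin> I \<longrightarrow> x $ i = 0)"
proof
  assume "lin_comb X x \<in> span (X ` I)"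
  moreover have "subspace (lin_comb X ` {y. \<forall>i. i \<notin> I \<longrightarrow> y $ i = 0})"
    by (intro linear_subspace_image[OF linear_lin_comb]) (auto simp: subspace_def)
  moreover have "X ` I \<subseteq> lin_comb X ` {y. \<forall>i. i \<notin> I \<longrightarrow> y $ i = 0}"
  proof
    fix v assume "v \<in> X ` I"
    then obtain i where "i \<in> I" "v = lin_comb X (axis i 1)" by (auto simp: lin_comb_axis)
    then show "v \<in> lin_comb X ` {y. \<forall>i. i \<notin> I \<longrightarrow> y $ i = 0}" by (auto simp: axis_def)
  qed
  ultimately have "lin_comb X x \<in> lin_comb X ` {y. \<forall>i. i \<notin> I \<longrightarrow> y $ i = 0}"
    using span_minimal by blast
  then show "\<forall>i. i \<notin> I \<longrightarrow> x $ i = 0"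
    by (simp add: image_iff lin_comb_eq_iff[OF X])
next
  assume z: "\<forall>i. i \<notin> I \<longrightarrow> x $ i = 0"
  show "lin_comb X x \<in> span (X ` I)"
    unfolding lin_comb_def
  proof (rule span_sum)
    fix i show "x $ i *\<^sub>R X i \<in> span (X ` I)"
      by (cases "i \<in> I") (use z in \<open>auto intro: span_scale span_base span_zero\<close>)
  qed
qed

text \<open>A definite subspace meets the span of the basis vectors of the wrong sign trivially; this
  bounds its dimension.\<close>

lemma Max_dim_definite:
  fixes X :: "'n::finite \<Rightarrow> 'a::euclidean_space"
  assumes X: "ordered_basis V X"
    and q: "\<And>x. q (lin_comb X x) = (\<Sum>i\<in>UNIV. r i * (x $ i)\<^sup>2)"
  shows "Max {dim W | W. subspace W \<and> W \<subseteq> V \<and> (\<forall>w\<in>W. w \<noteq> 0 \<longrightarrow> q w > 0)} = card {i. r i > (0::real)}"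
    (is "Max ?S = card ?P")
proof (rule Max_eqI)
  have sp: "span (range X) = V" using X by (simp add: ordered_basis_def)
  have dV: "dim V = card (UNIV :: 'n set)"
    using dim_basis_part[OF X, of UNIV] sp by simp
  \<comment> \<open>\<open>Max\<close> is meaningful only on a finite set; here the dimensions are
    bounded by \<open>dim V\<close>.\<close>
  have "?S \<subseteq> {..dim V}" by (auto intro: dim_subset)
  then show "finite ?S" by (rule finite_subset) simp
  show "card ?P \<in> ?S"
  \<comment> \<open>The maximum is attained by the span of the basis vectors with positive
    coefficient: all terms of \<open>q\<close> are nonnegative there, and a nonzero coordinate makes
    one of them positive.\<close>
  proof -
    have "q w > 0" if w: "w \<in> span (X ` ?P)" "w \<noteq> 0" for w
    proof -
      have "w \<in> V" using w(1) span_mono[of "X ` ?P" "range X"] sp by auto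
      then obtain x where x: "w = lin_comb X x" by (rule lin_comb_cases[OF X])
      have z: "x $ i = 0" if "\<not> r i > 0" for i
        using w(1) that unfolding x lin_comb_in_span_part[OF X] by simp
      have "x \<noteq> 0" using w(2) x by (auto simp: linear_0[OF linear_lin_comb])
      then obtain i where i: "x $ i \<noteq> 0" by (auto simp: vec_eq_iff)
      have nn: "0 \<le> r j * (x $ j)\<^sup>2" for j using z[of j] by (cases "r j > 0") auto
      have "0 < r i * (x $ i)\<^sup>2" using z[of i] i by (cases "r i > 0") auto
      then have "0 < (\<Sum>i\<in>UNIV. r i * (x $ i)\<^sup>2)"
        by (intro sum_pos2[of UNIV i]) (use nn in auto)
      then show ?thesis by (simp add: x q)
    qed
    moreover have "span (X ` ?P) \<subseteq> V" using span_mono[of "X ` ?P" "range X"] sp by auto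
    ultimately show ?thesis
      using dim_basis_part[OF X, of ?P] by (auto intro!: exI[of _ "span (X ` ?P)"])
  qed
  fix d assume "d \<in> ?S"
  then obtain W where W: "subspace W" "W \<subseteq> V" "\<And>w. w \<in> W \<Longrightarrow> w \<noteq> 0 \<Longrightarrow> q w > 0" and d: "d = dim W"
    by auto
  \<comment> \<open>\<open>q\<close> is nonpositive on \<open>?N\<close>, which includes the
    directions with \<open>r i = 0\<close>. The dimension formula for the sum of \<open>W\<close>
    and \<open>?N\<close> then yields \<open>dim W + dim ?N \<le> dim V\<close>.\<close>
  let ?N = "span (X ` (- ?P))"
  have "W \<inter> ?N \<subseteq> {0}"
  proof
    fix w assume w: "w \<in> W \<inter> ?N"
    obtain x where x: "w = lin_comb X x" using w W(2) by (auto elim: lin_comb_cases[OF X])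
    have z: "x $ i = 0" if "r i > 0" for i
      using w that unfolding x Int_iff lin_comb_in_span_part[OF X] by simp
    have "(\<Sum>i\<in>UNIV. r i * (x $ i)\<^sup>2) \<le> 0"
    proof (rule sum_nonpos)
      fix i show "r i * (x $ i)\<^sup>2 \<le> 0"
        using z[of i] by (cases "r i > 0") (auto simp: mult_nonpos_nonneg)
    qed
    then have "\<not> q w > 0" by (simp add: x q)
    then show "w \<in> {0}" using W(3) w by blast
  qed
  then have "dim (W \<inter> ?N) = 0" by (simp add: dim_eq_0)
  moreover have "dim {x + y | x y. x \<in> W \<and> y \<in> ?N} + dim (W \<inter> ?N) = dim W + dim ?N"
    using W(1) by (intro dim_sums_Int) auto
  moreover have "dim {x + y | x y. x \<in> W \<and> y \<in> ?N} \<le> dim V"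
  proof (rule dim_subset, clarify)
    fix x y assume "x \<in> W" "y \<in> ?N"
    then have "x \<in> V" "y \<in> V" using W(2) span_mono[of "X ` (- ?P)" "range X"] sp by auto
    then show "x + y \<in> V" using ordered_basis_subspace[OF X] by (intro subspace_add)
  qed
  moreover have "dim ?N = card (UNIV :: 'n set) - card ?P"
    by (simp only: dim_basis_part[OF X] Compl_eq_Diff_UNIV card_Diff_subset finite subset_UNIV)
  moreover have "card ?P \<le> card (UNIV :: 'n set)" by (rule card_mono) auto
  ultimately show "d \<le> card ?P" using dV d by linarith
qed

text \<open>The negative index is the positive index of \<open>- b\<close>, whose coefficients are
  \<open>- r i\<close>. The radical is spanned by the basis vectors with coefficient zero.\<close>

lemma form_signature_diagonal:
  fixes X :: "'n::finite \<Rightarrow> 'a::euclidean_space"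
  assumes X: "ordered_basis V X"
    and b: "\<And>x y. b (lin_comb X x) (lin_comb X y) = (\<Sum>i\<in>UNIV. r i * (x $ i * y $ i))"
  shows "form_signature V b = (card {i. r i > 0}, card {i. r i < 0}, card {i. r i = 0})"
proof -
  have pos: "Max {dim W | W. subspace W \<and> W \<subseteq> V \<and> (\<forall>w\<in>W. w \<noteq> 0 \<longrightarrow> b w w > 0)} = card {i. r i > 0}"
    by (rule Max_dim_definite[OF X]) (simp add: b power2_eq_square)
  have "Max {dim W | W. subspace W \<and> W \<subseteq> V \<and> (\<forall>w\<in>W. w \<noteq> 0 \<longrightarrow> - b w w > 0)} = card {i. - r i > 0}"
    by (rule Max_dim_definite[OF X]) (simp add: b power2_eq_square sum_negf)
  then have neg: "Max {dim W | W. subspace W \<and> W \<subseteq> V \<and> (\<forall>w\<in>W. w \<noteq> 0 \<longrightarrow> b w w < 0)} = card {i. r i < 0}"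
    by simp
  have "{v \<in> V. \<forall>w\<in>V. b v w = 0} = span (X ` {i. r i = 0})"
  proof (intro equalityI subsetI)
    fix v assume v: "v \<in> {v \<in> V. \<forall>w\<in>V. b v w = 0}"
    then obtain x where x: "v = lin_comb X x" by (auto elim: lin_comb_cases[OF X])
    have "r i * x $ i = 0" for i
    proof -
      \<comment> \<open>Pairing with the basis vector \<open>X i\<close> isolates the coordinate
        \<open>x $ i\<close>.\<close>
      have "b v (lin_comb X (axis i 1)) = (\<Sum>j\<in>UNIV. if j = i then r j * x $ j else 0)"
        unfolding x b by (rule sum.cong) (auto simp: axis_def)
      then show ?thesis using v lin_comb_in[OF X] by simp
    qed
    then show "v \<in> span (X ` {i. r i = 0})" by (auto simp: x lin_comb_in_span_part[OF X])
  next
    fix v assume v: "v \<in> span (X ` {i. r i = 0})"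
    have "span (X ` {i. r i = 0}) \<subseteq> span (range X)" by (intro span_mono) auto
    then have "v \<in> V" using v X by (auto simp: ordered_basis_def)
    then obtain x where x: "v = lin_comb X x" by (rule lin_comb_cases[OF X])
    have z: "r i = 0 \<or> x $ i = 0" for i
      using v by (auto simp: x lin_comb_in_span_part[OF X])
    have "b v w = 0" if w: "w \<in> V" for w
    proof -
      obtain y where "w = lin_comb X y" using w by (rule lin_comb_cases[OF X])
      then show ?thesis unfolding x using z by (simp add: b) (rule sum.neutral, auto)
    qed
    then show "v \<in> {v \<in> V. \<forall>w\<in>V. b v w = 0}" using \<open>v \<in> V\<close> by simp
  qed
  then show ?thesis
    unfolding form_signature_def pos neg by (simp only: dim_basis_part[OF X])
qed

text \<open>Provides the metrics that realise each signature in the theorem. They are written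
  through the coordinate functions of the basis \<open>X\<close>.\<close>

lemma diagonal_metric_exists:
  fixes X :: "'n::finite \<Rightarrow> 'a::real_vector"
  assumes X: "ordered_basis V X" and d: "\<And>i. d i \<noteq> 0"
  shows "\<exists>h. left_invariant_metric V h \<and>
    gram_matrix X h = (\<chi> i j. if i = j then d i else 0)"
proof -
  define c where "c v i = representation (range X) v (X i)" for v i
  define h where "h u v = (\<Sum>i\<in>UNIV. d i * (c u i * c v i))" for u v
  have c: "c (lin_comb X x) i = x $ i" for x i
    by (simp add: c_def representation_lin_comb[OF X])
  have add: "c (u + v) i = c u i + c v i" if "u \<in> V" "v \<in> V" for u v i
  proof -
    obtain x y where "u = lin_comb X x" "v = lin_comb X y"
      using \<open>u \<in> V\<close> \<open>v \<in> V\<close> by (meson lin_comb_cases[OF X])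
    then show ?thesis by (simp add: c lin_comb_add[symmetric])
  qed
  have scale: "c (s *\<^sub>R v) i = s * c v i" if "v \<in> V" for s v i
  proof -
    obtain y where "v = lin_comb X y" using \<open>v \<in> V\<close> by (rule lin_comb_cases[OF X])
    then show ?thesis by (simp add: c lin_comb_scale[symmetric])
  qed
  have cX: "c (X j) i = (if i = j then 1 else 0)" for i j
    using c[of "axis j 1" i] unfolding lin_comb_axis by (simp add: axis_def)
  have hX: "h u (X j) = d j * c u j" for u j
  proof -
    have "h u (X j) = (\<Sum>i\<in>UNIV. if i = j then d i * c u i else 0)"
      unfolding h_def cX by (rule sum.cong) auto
    then show ?thesis by simp
  qed
  have "bilinear_form_on V h"
    by (simp add: bilinear_form_on_def h_def add scale algebra_simps sum.distrib sum_distrib_left)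
  moreover have "symmetric_form_on V h"
    by (simp add: symmetric_form_on_def h_def mult.commute)
  moreover have "nondegenerate_form_on V h"
    unfolding nondegenerate_form_on_def
  proof (intro ballI impI)
    fix u assume u: "u \<in> V" and z: "\<forall>v\<in>V. h u v = 0"
    obtain x where x: "u = lin_comb X x" using u by (rule lin_comb_cases[OF X])
    have "x $ i = 0" for i
      using z ordered_basis_in[OF X, of i] hX[of u i] d[of i] by (simp add: x c)
    then show "u = 0" by (simp add: x lin_comb_def)
  qed
  moreover have "gram_matrix X h = (\<chi> i j. if i = j then d i else 0)"
    by (auto simp: gram_matrix_def vec_eq_iff hX cX)
  ultimately show ?thesis unfolding left_invariant_metric_def by blast
qed

section \<open>Diagonal metrics on the Lie algebra\<close>

text \<open>Twice the Euclidean cross product with its first component negated; the sign comes from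
  \<open>[X 3, X 2] = 2 X 1\<close>.\<close>

definition sl2_bracket :: "real ^ 3 \<Rightarrow> real ^ 3 \<Rightarrow> real ^ 3" where
  "sl2_bracket x y = vector [2 * (x$3 * y$2 - x$2 * y$3), 2 * (x$3 * y$1 - x$1 * y$3),
     2 * (x$1 * y$2 - x$2 * y$1)]"

lemma matrix_add_rdistrib: "(A + B) ** C = A ** C + B ** (C :: real ^ 'n ^ 'm)"
  by (simp add: matrix_matrix_mult_def vec_eq_iff sum.distrib distrib_right)

text \<open>In the expanded matrix products the squares \<open>X i ** X i\<close> cancel, and the
  mixed products pair up into the three brackets prescribed by
  \<open>standard_sl2_basis\<close>.\<close>

lemma commutator_lin_comb:
  assumes "standard_sl2_basis X"
  shows "commutator (lin_comb X x) (lin_comb X y) = lin_comb X (sl2_bracket x y)"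
proof -
  have e: "2 *\<^sub>R X 3 = X 1 ** X 2 - X 2 ** X 1" "2 *\<^sub>R X 2 = X 3 ** X 1 - X 1 ** X 3"
    "2 *\<^sub>R X 1 = X 3 ** X 2 - X 2 ** X 3"
    using assms by (simp_all add: standard_sl2_basis_def commutator_def)
  have "commutator (lin_comb X x) (lin_comb X y) =
      (x$3 * y$2 - x$2 * y$3) *\<^sub>R (X 3 ** X 2 - X 2 ** X 3) +
      (x$3 * y$1 - x$1 * y$3) *\<^sub>R (X 3 ** X 1 - X 1 ** X 3) +
      (x$1 * y$2 - x$2 * y$1) *\<^sub>R (X 1 ** X 2 - X 2 ** X 1)"
    by (simp add: commutator_def lin_comb_3 matrix_add_ldistrib matrix_add_rdistrib
        matrix_scalar_ac scalar_matrix_assoc[symmetric] algebra_simps)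
  then show ?thesis
    by (simp add: e[symmetric] lin_comb_3 sl2_bracket_def mult.commute)
qed

text \<open>The Levi-Civita product of the metric with entries \<open>- a\<close>, \<open>b\<close>,
  \<open>c\<close>, solved from the Koszul formula. For instance the product of \<open>X 1\<close>
  and \<open>X 2\<close> is \<open>(b + c - a) / c\<close> times \<open>X 3\<close>.\<close>

definition lc_coord :: "real \<Rightarrow> real \<Rightarrow> real \<Rightarrow> real ^ 3 \<Rightarrow> real ^ 3 \<Rightarrow> real ^ 3" where
  "lc_coord a b c x y = vector
     [(a + b - c) / a * (x$3 * y$2) - (a + c - b) / a * (x$2 * y$3),
      (a + b - c) / b * (x$3 * y$1) - (b + c - a) / b * (x$1 * y$3),
      (b + c - a) / c * (x$1 * y$2) - (a + c - b) / c * (x$2 * y$1)]"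

definition curv_coord :: "real \<Rightarrow> real \<Rightarrow> real \<Rightarrow> real ^ 3 \<Rightarrow> real ^ 3 \<Rightarrow> real ^ 3 \<Rightarrow> real ^ 3" where
  "curv_coord a b c x y z = lc_coord a b c (sl2_bracket x y) z -
     (lc_coord a b c x (lc_coord a b c y z) - lc_coord a b c y (lc_coord a b c x z))"

text \<open>These are entries of the Ricci form; the eigenvalues of the Ricci operator arise from
  them on division by \<open>- a\<close>, \<open>b\<close>, \<open>c\<close>.\<close>

definition ric_diag :: "real \<Rightarrow> real \<Rightarrow> real \<Rightarrow> real ^ 3" where
  "ric_diag a b c = vector [2 * (a\<^sup>2 - (b - c)\<^sup>2) / (b * c),
     - (2 * (b\<^sup>2 - (a - c)\<^sup>2) / (a * c)), - (2 * (c\<^sup>2 - (b - a)\<^sup>2) / (a * b))]"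

section \<open>Linearity and contraction of the coordinate formulas\<close>

lemma linear_sl2_bracket: "linear (sl2_bracket x)"
  by (rule linearI) (auto simp: sl2_bracket_def vec_eq_iff forall_3 algebra_simps)

lemma linear_lc_coord_left: "linear (\<lambda>x. lc_coord a b c x y)"
proof -
  \<comment> \<open>Linearity concerns only the monomials, so the six quotients are generalised to
    arbitrary constants.\<close>
  have "linear (\<lambda>x. vector [A * (x$3 * y$2) - B * (x$2 * y$3), C * (x$3 * y$1) - D * (x$1 * y$3),
      E * (x$1 * y$2) - F * (x$2 * y$1)] :: real ^ 3)" for A B C D E F
    by (rule linearI) (auto simp: vec_eq_iff forall_3 algebra_simps)
  then show ?thesis unfolding lc_coord_def .
qed

lemma linear_lc_coord_right: "linear (lc_coord a b c x)"
proof -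
  have "linear (\<lambda>y. vector [A * (x$3 * y$2) - B * (x$2 * y$3), C * (x$3 * y$1) - D * (x$1 * y$3),
      E * (x$1 * y$2) - F * (x$2 * y$1)] :: real ^ 3)" for A B C D E F
    by (rule linearI) (auto simp: vec_eq_iff forall_3 algebra_simps)
  then have "linear (\<lambda>y. lc_coord a b c x y)" unfolding lc_coord_def .
  then show ?thesis by simp
qed

text \<open>The second argument is the one over which \<open>ricci\<close> takes the trace.\<close>

lemma linear_curv_coord: "linear (\<lambda>y. curv_coord a b c x y z)"
proof -
  have "linear (\<lambda>y. lc_coord a b c (sl2_bracket x y) z)"
    "linear (\<lambda>y. lc_coord a b c x (lc_coord a b c y z))"
    using linear_compose[OF linear_sl2_bracket linear_lc_coord_left]
      linear_compose[OF linear_lc_coord_left linear_lc_coord_right]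
    by (simp_all add: o_def)
  then show ?thesis
    unfolding curv_coord_def by (intro linear_compose_sub linear_lc_coord_left)
qed

lemma trace_curv_coord:
  assumes "a \<noteq> 0" "b \<noteq> 0" "c \<noteq> 0"
  shows "(\<Sum>i\<in>UNIV. curv_coord a b c x (axis i 1) y $ i) = (\<Sum>i\<in>UNIV. ric_diag a b c $ i * (x $ i * y $ i))"
proof -
  \<comment> \<open>Naming the quotients makes the trace a polynomial computation; division enters
    only when its three coefficients are identified.\<close>
  define A B C D E F where "A = (a + b - c) / a" and "B = (a + c - b) / a" and
    "C = (a + b - c) / b" and "D = (b + c - a) / b" and
    "E = (b + c - a) / c" and "F = (a + c - b) / c"
  note defs = A_def B_def C_def D_def E_def F_def
  have L: "lc_coord a b c x y = vector [A * (x$3 * y$2) - B * (x$2 * y$3),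
      C * (x$3 * y$1) - D * (x$1 * y$3), E * (x$1 * y$2) - F * (x$2 * y$1)]" for x y
    by (simp only: lc_coord_def defs)
  have "(\<Sum>i\<in>UNIV. curv_coord a b c x (axis i 1) y $ i) =
      (2 * C + 2 * F - D * F - C * E) * (x$1 * y$1) - (2 * A + 2 * E - B * E - A * F) * (x$2 * y$2)
      - (2 * B + 2 * D - A * D - B * C) * (x$3 * y$3)"
    by (simp add: sum_3 curv_coord_def L sl2_bracket_def axis_def algebra_simps)
  \<comment> \<open>Vanishing torsion reads \<open>A + B = C + D = E + F = 2\<close>, so the three
    coefficients equal \<open>2 * C * F\<close>, \<open>2 * A * E\<close> and
    \<open>2 * B * D\<close>. Each numerator is then a difference of squares.\<close>
  moreover have "2 * C + 2 * F - D * F - C * E = ric_diag a b c $ 1"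
    using assms by (simp add: ric_diag_def defs field_simps power2_eq_square)
  moreover have "2 * A + 2 * E - B * E - A * F = - ric_diag a b c $ 2"
    using assms by (simp add: ric_diag_def defs field_simps power2_eq_square)
  moreover have "2 * B + 2 * D - A * D - B * C = - ric_diag a b c $ 3"
    using assms by (simp add: ric_diag_def defs field_simps power2_eq_square)
  ultimately show ?thesis by (simp add: sum_3)
qed

text \<open>All six quotients become 1 and the Levi-Civita product is half the bracket, as for any
  bi-invariant metric. The curvature is then a quarter of a double bracket, and the identity is the
  Lorentzian version of the triple product expansion.\<close>

lemma curv_coord_equal:
  assumes "m \<noteq> 0"
  shows "curv_coord m m m x y z =
    (- (y$1 * z$1) + y$2 * z$2 + y$3 * z$3) *\<^sub>R x - (- (x$1 * z$1) + x$2 * z$2 + x$3 * z$3) *\<^sub>R y"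
proof -
  have L: "lc_coord m m m x y = vector [x$3 * y$2 - x$2 * y$3, x$3 * y$1 - x$1 * y$3, x$1 * y$2 - x$2 * y$1]" for x y
    using assms by (simp add: lc_coord_def)
  show ?thesis
    by (simp add: curv_coord_def L sl2_bracket_def vec_eq_iff forall_3 algebra_simps)
qed

section \<open>Curvature of \<open>sl2\<close> with a diagonal metric, transferred from
  coordinates\<close>

locale diagonal_sl2_metric =
  fixes X :: "3 \<Rightarrow> real ^ 2 ^ 2" and h :: "real ^ 2 ^ 2 \<Rightarrow> real ^ 2 ^ 2 \<Rightarrow> real" and a b c :: real
  assumes standard: "standard_sl2_basis X"
    and pos: "a > 0" "b > 0" "c > 0"
    and metric: "left_invariant_metric sl2 h"
    and gram: "gram_matrix X h = diag3 (- a) b c"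
begin

lemma basis: "ordered_basis sl2 X"
  using standard by (simp add: standard_sl2_basis_def)

lemma h_lin_comb:
  "h (lin_comb X x) (lin_comb X y) = - a * (x$1 * y$1) + b * (x$2 * y$2) + c * (x$3 * y$3)"
proof -
  have "h (X i) (X j) = diag3 (- a) b c $ i $ j" for i j
    using gram by (auto simp: gram_matrix_def vec_eq_iff)
  then show ?thesis
    using bilinear_form_on_lin_comb[OF basis, of h x y] metric
    by (simp add: left_invariant_metric_def sum_3 diag3_def)
qed

text \<open>The candidate satisfies the Koszul formula by a computation in coordinates, and
  \<open>metric_cancel\<close> makes it the only solution.\<close>

lemma levi_civita_lin_comb:
  "levi_civita sl2 commutator h (lin_comb X x) (lin_comb X y) = lin_comb X (lc_coord a b c x y)"
  unfolding levi_civita_def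
proof (rule the_equality)
  let ?P = "\<lambda>z w. 2 * h z w = h (commutator (lin_comb X x) (lin_comb X y)) w +
    h (commutator w (lin_comb X x)) (lin_comb X y) + h (commutator w (lin_comb X y)) (lin_comb X x)"
  have eq: "?P (lin_comb X (lc_coord a b c x y)) w" if "w \<in> sl2" for w
  proof -
    obtain t where t: "w = lin_comb X t" using \<open>w \<in> sl2\<close> by (rule lin_comb_cases[OF basis])
    show ?thesis
      unfolding t commutator_lin_comb[OF standard] h_lin_comb
      using pos by (simp add: lc_coord_def sl2_bracket_def field_simps)
  qed
  then show "lin_comb X (lc_coord a b c x y) \<in> sl2 \<and> (\<forall>w\<in>sl2. ?P (lin_comb X (lc_coord a b c x y)) w)"
    using lin_comb_in[OF basis] by blast
  fix z assume z: "z \<in> sl2 \<and> (\<forall>w\<in>sl2. ?P z w)"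
  show "z = lin_comb X (lc_coord a b c x y)"
  proof (rule metric_cancel[OF ordered_basis_subspace[OF basis] metric])
    fix w assume "w \<in> sl2"
    then have "2 * h z w = 2 * h (lin_comb X (lc_coord a b c x y)) w" using z eq by metis
    then show "h z w = h (lin_comb X (lc_coord a b c x y)) w" by simp
  qed (use z lin_comb_in[OF basis] in auto)
qed

lemma curvature_lin_comb:
  "curvature sl2 commutator h (lin_comb X x) (lin_comb X y) (lin_comb X z) =
    lin_comb X (curv_coord a b c x y z)"
  by (simp add: curvature_def Let_def commutator_lin_comb[OF standard] levi_civita_lin_comb
      curv_coord_def lin_comb_diff)

lemma ricci_lin_comb:
  "ricci sl2 commutator h (lin_comb X x) (lin_comb X y) = (\<Sum>i\<in>UNIV. ric_diag a b c $ i * (x $ i * y $ i))"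
proof -
  have "ricci sl2 commutator h (lin_comb X x) (lin_comb X y) =
      (\<Sum>i\<in>UNIV. curv_coord a b c x (axis i 1) y $ i)"
    unfolding ricci_def by (rule trace_on_lin_comb[OF basis linear_curv_coord curvature_lin_comb])
  then show ?thesis using trace_curv_coord pos by simp
qed

lemma gram_ricci:
  "gram_matrix X (ricci sl2 commutator h) = diag3 (ric_diag a b c $ 1) (ric_diag a b c $ 2) (ric_diag a b c $ 3)"
proof -
  have "ricci sl2 commutator h (X i) (X j) =
      (\<Sum>k\<in>UNIV. ric_diag a b c $ k * (axis i 1 $ k * axis j 1 $ k))" for i j
    using ricci_lin_comb[of "axis i 1" "axis j 1"] by (simp add: lin_comb_axis)
  then show ?thesis
    by (simp add: gram_matrix_def diag3_def vec_eq_iff forall_3 sum_3 axis_def)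
qed

text \<open>Raising an index with a diagonal metric divides each entry by \<open>- a\<close>,
  \<open>b\<close>, \<open>c\<close>; uniqueness is again \<open>metric_cancel\<close>.\<close>

lemma ricci_operator_lin_comb:
  "ricci_operator sl2 commutator h (lin_comb X x) =
    lin_comb X (vector [ric_diag a b c $ 1 / (- a) * x$1, ric_diag a b c $ 2 / b * x$2, ric_diag a b c $ 3 / c * x$3])"
    (is "_ = lin_comb X ?y")
  unfolding ricci_operator_def
proof (rule the_equality)
  have eq: "h (lin_comb X ?y) v = ricci sl2 commutator h (lin_comb X x) v" if "v \<in> sl2" for v
  proof -
    obtain t where t: "v = lin_comb X t" using \<open>v \<in> sl2\<close> by (rule lin_comb_cases[OF basis])
    show ?thesis
      unfolding t h_lin_comb ricci_lin_comb using pos by (simp add: sum_3)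
  qed
  then show "lin_comb X ?y \<in> sl2 \<and> (\<forall>v\<in>sl2. h (lin_comb X ?y) v = ricci sl2 commutator h (lin_comb X x) v)"
    using lin_comb_in[OF basis] by blast
  fix z assume "z \<in> sl2 \<and> (\<forall>v\<in>sl2. h z v = ricci sl2 commutator h (lin_comb X x) v)"
  then show "z = lin_comb X ?y"
    using lin_comb_in[OF basis] eq
    by (intro metric_cancel[OF ordered_basis_subspace[OF basis] metric]) auto
qed

lemma scalar_curvature_eq:
  "scalar_curvature sl2 commutator h =
    2 * ((sqrt a + sqrt b)\<^sup>2 - c) * ((sqrt a - sqrt b)\<^sup>2 - c) / (a * b * c)"
proof -
  let ?F = "\<lambda>x. vector [ric_diag a b c $ 1 / (- a) * x$1, ric_diag a b c $ 2 / b * x$2,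
    ric_diag a b c $ 3 / c * x$3] :: real ^ 3"
  have "linear ?F"
    by (rule linearI) (auto simp: vec_eq_iff forall_3 algebra_simps add_divide_distrib)
  then have "scalar_curvature sl2 commutator h = (\<Sum>i\<in>UNIV. ?F (axis i 1) $ i)"
    unfolding scalar_curvature_def
    by (rule trace_on_lin_comb[OF basis]) (rule ricci_operator_lin_comb)
  also have "\<dots> = 2 * (a\<^sup>2 + b\<^sup>2 + c\<^sup>2 - 2 * a * b - 2 * b * c - 2 * c * a) / (a * b * c)"
    using pos by (simp add: sum_3 axis_def ric_diag_def field_simps power2_eq_square)
  also have "a\<^sup>2 + b\<^sup>2 + c\<^sup>2 - 2 * a * b - 2 * b * c - 2 * c * a =
      ((sqrt a + sqrt b)\<^sup>2 - c) * ((sqrt a - sqrt b)\<^sup>2 - c)"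
  \<comment> \<open>The two factors are \<open>(a + b - c) + 2 s\<close> and
    \<open>(a + b - c) - 2 s\<close> with \<open>s = sqrt a * sqrt b\<close>, so their product is
    \<open>(a + b - c)\<^sup>2 - 4 * a * b\<close>.\<close>
  proof -
    have "(sqrt a + sqrt b)\<^sup>2 = a + b + 2 * (sqrt a * sqrt b)"
      "(sqrt a - sqrt b)\<^sup>2 = a + b - 2 * (sqrt a * sqrt b)"
      using pos by (simp_all add: power2_sum power2_diff)
    moreover have "(sqrt a * sqrt b)\<^sup>2 = a * b" using pos by (simp add: power_mult_distrib)
    ultimately show ?thesis by algebra
  qed
  finally show ?thesis by (simp add: mult.assoc)
qed

lemma ricci_signature:
  "form_signature sl2 (ricci sl2 commutator h) =
    (card {i. ric_diag a b c $ i > 0}, card {i. ric_diag a b c $ i < 0}, card {i. ric_diag a b c $ i = 0})"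
  by (rule form_signature_diagonal[OF basis ricci_lin_comb])

end

section \<open>Signs of the Ricci form and the resulting signatures\<close>

lemma card_Collect_3:
  "card {i :: 3. P i} = (if P 1 then 1 else 0) + (if P 2 then 1 else 0) + (if P 3 then 1 else 0)"
proof -
  have "{i :: 3. P i} = (if P 1 then {1} else {}) \<union> (if P 2 then {2} else {}) \<union> (if P 3 then {3} else {})"
    by (auto simp: set_eq_iff forall_3)
  then show ?thesis by simp
qed

text \<open>For \<open>b \<ge> c\<close> the signs of the Ricci eigenvalues are those of \<open>p\<close>, \<open>- q\<close> and \<open>- p q\<close>,
  where \<open>p = a + c - b\<close> and \<open>q = b + c - a\<close> are not both \<open>\<le> 0\<close> since \<open>p + q = 2 c\<close>.\<close>

lemma sgn_ric_diag:
  assumes "a > 0" "b \<ge> c" "c > 0"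
  shows "sgn (ric_diag a b c $ 1) = sgn (a + c - b)"
    "sgn (ric_diag a b c $ 2) = - sgn (b + c - a)"
    "sgn (ric_diag a b c $ 3) = - (sgn (a + c - b) * sgn (b + c - a))"
proof -
  have f: "a\<^sup>2 - (b - c)\<^sup>2 = (a + c - b) * (a + b - c)" "b\<^sup>2 - (a - c)\<^sup>2 = (b + c - a) * (a + b - c)"
    "c\<^sup>2 - (b - a)\<^sup>2 = (a + c - b) * (b + c - a)"
    by (simp_all add: power2_eq_square algebra_simps)
  \<comment> \<open>The common factor \<open>a + b - c\<close> is positive because
    \<open>b \<ge> c\<close> and \<open>a > 0\<close>, so it does not affect the signs.\<close>
  have p: "sgn (a + b - c) = 1" "sgn a = 1" "sgn b = 1" "sgn c = 1"
    using assms by simp_all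
  show "sgn (ric_diag a b c $ 1) = sgn (a + c - b)"
    "sgn (ric_diag a b c $ 2) = - sgn (b + c - a)"
    "sgn (ric_diag a b c $ 3) = - (sgn (a + c - b) * sgn (b + c - a))"
    unfolding ric_diag_def vector_3 f by (simp_all add: sgn_mult sgn_divide sgn_minus p)
qed

text \<open>With \<open>p = a + c - b\<close> and \<open>q = b + c - a\<close> the cases are
  \<open>p = 0\<close>, \<open>q = 0\<close>, \<open>q < 0\<close> and the rest. The rest joins two
  sign patterns, \<open>(+,-,-)\<close> for \<open>p > 0\<close> and \<open>(-,-,+)\<close> for
  \<open>p < 0\<close>, which have the same signature.\<close>

lemma (in diagonal_sl2_metric) ricci_signature_cases:
  assumes "b \<ge> c"
  shows "form_signature sl2 (ricci sl2 commutator h) =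
    (if a + c = b then (0, 1, 2) else if a = b + c then (1, 0, 2)
     else if a > b + c then (3, 0, 0) else (1, 2, 0))"
proof -
  note s = sgn_ric_diag[OF pos(1) assms pos(3)]
  have sg: "(ric_diag a b c $ i > 0) = (sgn (ric_diag a b c $ i) = 1)"
    "(ric_diag a b c $ i < 0) = (sgn (ric_diag a b c $ i) = -1)"
    "(ric_diag a b c $ i = 0) = (sgn (ric_diag a b c $ i) = 0)" for i
    by (simp_all add: sgn_1_pos sgn_1_neg sgn_0_0)
  show ?thesis
    unfolding ricci_signature card_Collect_3 sg s
    using pos assms by (auto simp: sgn_real_def)
qed

section \<open>Curvature formulas, the constant curvature case and the list of signatures\<close>

theorem proposition4p3:
  fixes X :: "3 \<Rightarrow> real ^ 2 ^ 2"
  assumes "standard_sl2_basis X"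
  shows
    "(\<forall>\<mu>1 \<mu>2 \<mu>3 h. \<mu>1 > 0 \<and> \<mu>2 \<ge> \<mu>3 \<and> \<mu>3 > 0 \<and>
        left_invariant_metric sl2 h \<and> gram_matrix X h = diag3 (- \<mu>1) \<mu>2 \<mu>3 \<longrightarrow>
        gram_matrix X (ricci sl2 commutator h) =
          diag3 (2 * (\<mu>1\<^sup>2 - (\<mu>2 - \<mu>3)\<^sup>2) / (\<mu>2 * \<mu>3))
                (- (2 * (\<mu>2\<^sup>2 - (\<mu>1 - \<mu>3)\<^sup>2) / (\<mu>1 * \<mu>3)))
                (- (2 * (\<mu>3\<^sup>2 - (\<mu>2 - \<mu>1)\<^sup>2) / (\<mu>1 * \<mu>2))) \<and>
        scalar_curvature sl2 commutator h =
          2 * ((sqrt \<mu>1 + sqrt \<mu>2)\<^sup>2 - \<mu>3) * ((sqrt \<mu>1 - sqrt \<mu>2)\<^sup>2 - \<mu>3) / (\<mu>1 * \<mu>2 * \<mu>3)) \<and>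
     (\<forall>\<mu> h. \<mu> > 0 \<and>
        left_invariant_metric sl2 h \<and> gram_matrix X h = diag3 (- \<mu>) \<mu> \<mu> \<longrightarrow>
        (\<forall>u\<in>sl2. \<forall>v\<in>sl2. ricci sl2 commutator h u v = - (2 / \<mu>) * h u v) \<and>
        constant_sectional_curvature sl2 commutator h (- (1 / \<mu>))) \<and>
     {form_signature sl2 (ricci sl2 commutator h) | h \<mu>1 \<mu>2 \<mu>3.
        \<mu>1 > 0 \<and> \<mu>2 \<ge> \<mu>3 \<and> \<mu>3 > 0 \<and>
        left_invariant_metric sl2 h \<and> gram_matrix X h = diag3 (- \<mu>1) \<mu>2 \<mu>3}
       = {(3, 0, 0), (1, 2, 0), (1, 0, 2), (0, 1, 2)}"
proof (intro conjI allI impI)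
  fix \<mu>1 \<mu>2 \<mu>3 h
  assume "\<mu>1 > 0 \<and> \<mu>2 \<ge> \<mu>3 \<and> \<mu>3 > 0 \<and>
    left_invariant_metric sl2 h \<and> gram_matrix X h = diag3 (- \<mu>1) \<mu>2 \<mu>3"
  then interpret diagonal_sl2_metric X h \<mu>1 \<mu>2 \<mu>3
    using assms by unfold_locales auto
  show "gram_matrix X (ricci sl2 commutator h) =
      diag3 (2 * (\<mu>1\<^sup>2 - (\<mu>2 - \<mu>3)\<^sup>2) / (\<mu>2 * \<mu>3))
            (- (2 * (\<mu>2\<^sup>2 - (\<mu>1 - \<mu>3)\<^sup>2) / (\<mu>1 * \<mu>3)))
            (- (2 * (\<mu>3\<^sup>2 - (\<mu>2 - \<mu>1)\<^sup>2) / (\<mu>1 * \<mu>2)))"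
    unfolding gram_ricci ric_diag_def vector_3 ..
  show "scalar_curvature sl2 commutator h =
      2 * ((sqrt \<mu>1 + sqrt \<mu>2)\<^sup>2 - \<mu>3) * ((sqrt \<mu>1 - sqrt \<mu>2)\<^sup>2 - \<mu>3) / (\<mu>1 * \<mu>2 * \<mu>3)"
    by (rule scalar_curvature_eq)
next
  fix \<mu> h
  assume "\<mu> > 0 \<and> left_invariant_metric sl2 h \<and> gram_matrix X h = diag3 (- \<mu>) \<mu> \<mu>"
  then interpret diagonal_sl2_metric X h \<mu> \<mu> \<mu>
    using assms by unfold_locales auto
  show "\<forall>u\<in>sl2. \<forall>v\<in>sl2. ricci sl2 commutator h u v = - (2 / \<mu>) * h u v"
  proof (intro ballI)
    fix u v assume "u \<in> sl2" "v \<in> sl2"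
    then obtain x y where uv: "u = lin_comb X x" "v = lin_comb X y"
      by (meson lin_comb_cases[OF basis])
    \<comment> \<open>For equal parameters the Ricci entries are 2, -2, -2, against the metric
      entries \<open>- \<mu>\<close>, \<open>\<mu>\<close>, \<open>\<mu>\<close>.\<close>
    show "ricci sl2 commutator h u v = - (2 / \<mu>) * h u v"
      unfolding uv ricci_lin_comb h_lin_comb using pos
      by (simp add: sum_3 ric_diag_def field_simps power2_eq_square)
  qed
  show "constant_sectional_curvature sl2 commutator h (- (1 / \<mu>))"
    unfolding constant_sectional_curvature_def
  proof (intro ballI)
    fix u v w assume "u \<in> sl2" "v \<in> sl2" "w \<in> sl2"
    then obtain x y z where uvw: "u = lin_comb X x" "v = lin_comb X y" "w = lin_comb X z"
      by (meson lin_comb_cases[OF basis])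
    have "curvature sl2 commutator h u v w = lin_comb X (curv_coord \<mu> \<mu> \<mu> x y z)"
      unfolding uvw by (rule curvature_lin_comb)
    also have "\<dots> = (h v w / \<mu>) *\<^sub>R u - (h u w / \<mu>) *\<^sub>R v"
    proof -
      \<comment> \<open>The form with entries -1, 1, 1 in \<open>curv_coord_equal\<close> is
        \<open>h\<close> divided by \<open>\<mu>\<close>; this factor is the source of the constant
        \<open>- (1 / \<mu>)\<close>.\<close>
      have "h (lin_comb X s) (lin_comb X t) / \<mu> = - (s$1 * t$1) + s$2 * t$2 + s$3 * t$3" for s t
        using pos by (simp add: h_lin_comb field_simps)
      then show ?thesis
        using pos by (simp add: curv_coord_equal uvw lin_comb_scale lin_comb_diff)
    qed
    finally show "curvature sl2 commutator h u v w = (- (- (1 / \<mu>))) *\<^sub>R (h v w *\<^sub>R u - h u w *\<^sub>R v)"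
      by (simp add: scaleR_diff_right)
  qed
next
  define S where "S = {form_signature sl2 (ricci sl2 commutator h) | h \<mu>1 \<mu>2 \<mu>3.
        \<mu>1 > 0 \<and> \<mu>2 \<ge> \<mu>3 \<and> \<mu>3 > 0 \<and>
        left_invariant_metric sl2 h \<and> gram_matrix X h = diag3 (- \<mu>1) \<mu>2 \<mu>3}"
  have signature: "form_signature sl2 (ricci sl2 commutator h) =
      (if \<mu>1 + \<mu>3 = \<mu>2 then (0, 1, 2) else if \<mu>1 = \<mu>2 + \<mu>3 then (1, 0, 2)
       else if \<mu>1 > \<mu>2 + \<mu>3 then (3, 0, 0) else (1, 2, 0))"
    if "\<mu>1 > 0" "\<mu>2 \<ge> \<mu>3" "\<mu>3 > 0" "left_invariant_metric sl2 h" "gram_matrix X h = diag3 (- \<mu>1) \<mu>2 \<mu>3"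
    for h and \<mu>1 \<mu>2 \<mu>3 :: real
  proof -
    interpret diagonal_sl2_metric X h \<mu>1 \<mu>2 \<mu>3
      using assms that by unfold_locales auto
    show ?thesis using that(2) by (rule ricci_signature_cases)
  qed
  \<comment> \<open>Keeping the case distinction symbolic lets each signature be obtained below by
    inserting numbers; \<open>diagonal_metric_exists\<close> supplies the metric.\<close>
  have attained: "(if \<mu>1 + \<mu>3 = \<mu>2 then (0, 1, 2) else if \<mu>1 = \<mu>2 + \<mu>3 then (1, 0, 2)
       else if \<mu>1 > \<mu>2 + \<mu>3 then (3, 0, 0) else (1, 2, 0)) \<in> S"
    if m: "\<mu>1 > 0" "\<mu>2 \<ge> \<mu>3" "\<mu>3 > 0" for \<mu>1 \<mu>2 \<mu>3 :: real
  proof -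
    have basis: "ordered_basis sl2 X" using assms by (simp add: standard_sl2_basis_def)
    have "(vector [- \<mu>1, \<mu>2, \<mu>3] :: real ^ 3) $ i \<noteq> 0" for i
    proof -
      have "\<forall>i. (vector [- \<mu>1, \<mu>2, \<mu>3] :: real ^ 3) $ i \<noteq> 0" using m by (simp add: forall_3)
      then show ?thesis by blast
    qed
    then obtain h where h: "left_invariant_metric sl2 h"
      "gram_matrix X h = (\<chi> i j. if i = j then (vector [- \<mu>1, \<mu>2, \<mu>3] :: real ^ 3) $ i else 0)"
      using diagonal_metric_exists[OF basis, of "\<lambda>i. (vector [- \<mu>1, \<mu>2, \<mu>3] :: real ^ 3) $ i"] by auto
    then have gram: "gram_matrix X h = diag3 (- \<mu>1) \<mu>2 \<mu>3"
      by (simp add: diag3_def vec_eq_iff forall_3)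
    show ?thesis
      unfolding S_def mem_Collect_eq
      by (intro exI conjI) (fact signature[OF m h(1) gram, symmetric] m h(1) gram)+
  qed
  \<comment> \<open>For the second inclusion the triples \<open>(\<mu>1, \<mu>2, \<mu>3)\<close> are
    (3,1,1), (1,1,1), (2,1,1) and (1,2,1), one in each case of \<open>signature\<close>.\<close>
  have "S = {(3, 0, 0), (1, 2, 0), (1, 0, 2), (0, 1, 2)}"
  proof
    show "S \<subseteq> {(3, 0, 0), (1, 2, 0), (1, 0, 2), (0, 1, 2)}"
    proof
      fix s assume "s \<in> S"
      then obtain h \<mu>1 \<mu>2 \<mu>3 where s: "s = form_signature sl2 (ricci sl2 commutator h)"
        and m: "\<mu>1 > 0" "\<mu>2 \<ge> \<mu>3" "\<mu>3 > 0" "left_invariant_metric sl2 h"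
          "gram_matrix X h = diag3 (- \<mu>1) \<mu>2 \<mu>3"
        unfolding S_def mem_Collect_eq by (elim exE conjE)
      show "s \<in> {(3, 0, 0), (1, 2, 0), (1, 0, 2), (0, 1, 2)}"
        unfolding s signature[OF m] by simp
    qed
    \<comment> \<open>the arguments of \<open>attained\<close> come in the order \<open>\<mu>1\<close>, \<open>\<mu>3\<close>, \<open>\<mu>2\<close>\<close>
    have "(3, 0, 0) \<in> S" "(1, 2, 0) \<in> S" "(1, 0, 2) \<in> S" "(0, 1, 2) \<in> S"
      using attained[of 3 1 1] attained[of 1 1 1] attained[of 2 1 1] attained[of 1 1 2] by simp_all
    then show "{(3, 0, 0), (1, 2, 0), (1, 0, 2), (0, 1, 2)} \<subseteq> S"
      by (intro insert_subsetI empty_subsetI)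
  qed
  then show "{form_signature sl2 (ricci sl2 commutator h) | h \<mu>1 \<mu>2 \<mu>3.
        \<mu>1 > 0 \<and> \<mu>2 \<ge> \<mu>3 \<and> \<mu>3 > 0 \<and>
        left_invariant_metric sl2 h \<and> gram_matrix X h = diag3 (- \<mu>1) \<mu>2 \<mu>3}
      = {(3, 0, 0), (1, 2, 0), (1, 0, 2), (0, 1, 2)}" unfolding S_def .
qed

end
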